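(* Let $\alpha,\delta\in\mathbb{N}=\{1,2,3,\dots\}$, $p\in\mathbb{N}_0=\{0,1,2,\dots\}$, $\gamma=\alpha p$, and let $n\in\mathbb{N}_0$, $m\in\mathbb{N}$. Let $X_{n,m}$ be the number of remaining white balls, divided by $\alpha$, at the moment when all black balls have been drawn, in the two-colour urn with ball replacement matrix $M=\begin{pmatrix}-\alpha & 0\\ \gamma & -\delta\end{pmatrix}$ started with $\alpha n$ white and $\delta m$ black balls. Then the probability generating function $h_{n,m}(v)=\mathbb{E}(v^{X_{n,m}})$ is given by $$h_{n,m}(v)=\int_{0}^{\infty}\big(1+(v-1)e^{-\alpha t}\big)^n\cdot\Big(\int_{0}^{t}\delta e^{-\delta u}\,\big(1+(v-1)e^{-\alpha(t-u)}\big)^{p}\,du\Big)^{m-1}\cdot v^p\, m\,\delta\, e^{-\delta t}\,dt.$$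
   Context: Urn model: at each discrete step a ball is drawn uniformly at random from the urn, its colour is inspected, and it is put back. If it is white, $\alpha$ white balls are removed; if it is black, $\gamma=\alpha p$ white balls are added and $\delta$ black balls are removed. The process stops as soon as no black balls are left. The urn starts with $\alpha n$ white and $\delta m$ black balls. Equivalently, counting white balls in units of $\alpha$ and black balls in units of $\delta$, the state $(n,m)$ with $m\ge 1$ moves to $(n-1,m)$ with probability $\frac{\alpha n}{\alpha n+\delta m}$ and to $(n+p,m-1)$ with probability $\frac{\delta m}{\alpha n+\delta m}$, and $X_{n,m}$ is the first coordinate of the state when the second coordinate first reaches $0$. Thus $h_{n,m}(v)$ satisfies, for $n\ge 0$ and $m\ge 1$, $$h_{n,m}(v)=\frac{\alpha n}{\alpha n+\delta m}h_{n-1,m}(v)+\frac{\delta m}{\alpha n+\delta m}h_{n+p,m-1}(v),\qquad h_{n,0}(v)=v^n,$$ where for $n=0$ the first term is $0$. *)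

theory Defs
  imports "HOL-Probability.Probability"
begin

text \<open>
  States are pairs (number of white balls, number of black balls). In a replacement matrix, index 1
  is white and index 2 is black; the row is the colour drawn, the column the colour added
  (removed, if the entry is negative). The balls in the urn are numbered \<open>0, \<dots>, w + b - 1\<close>, the
  first \<open>w\<close> of them being white. The urn is frozen once there is no black ball left.
\<close>

definition urn_step :: "int^2^2 \<Rightarrow> int \<times> int \<Rightarrow> (int \<times> int) pmf" where
  "urn_step R = (\<lambda>(w, b).
     if b = 0 then return_pmf (w, b)
     else map_pmf
       (\<lambda>ball. if ball < w then (w + R$1$1, b + R$1$2) else (w + R$2$1, b + R$2$2))
       (pmf_of_set {0..<w + b}))"

locale urn_process = prob_space P for P :: "'a measure" +
  fixes R :: "int^2^2" and s\<^sub>0 :: "int \<times> int" and S :: "nat \<Rightarrow> 'a \<Rightarrow> int \<times> int"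
  assumes measurable_state: "\<And>k. S k \<in> measurable P (count_space UNIV)"
    and initial_state: "AE \<omega> in P. S 0 \<omega> = s\<^sub>0"
    and transition: "\<And>k path s.
      prob {\<omega> \<in> space P. (\<forall>i\<le>k. S i \<omega> = path i) \<and> S (Suc k) \<omega> = s} =
      prob {\<omega> \<in> space P. \<forall>i\<le>k. S i \<omega> = path i} * pmf (urn_step R (path k)) s"

definition stopping_step :: "(nat \<Rightarrow> 'a \<Rightarrow> int \<times> int) \<Rightarrow> 'a \<Rightarrow> nat" where
  "stopping_step S \<omega> = (LEAST k. snd (S k \<omega>) = 0)"

text \<open>
  If all replacements of white balls and the initial number of white balls are multiples of
  \<open>\<alpha>\<close>, the division below is exact; the conversion to a natural number is exact as long as no
  colour is overdrawn.
\<close>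

definition remaining_white :: "nat \<Rightarrow> (nat \<Rightarrow> 'a \<Rightarrow> int \<times> int) \<Rightarrow> 'a \<Rightarrow> nat" where
  "remaining_white \<alpha> S \<omega> = nat (fst (S (stopping_step S \<omega>) \<omega>) div int \<alpha>)"

end

theory Submission
  imports Defs
begin

text \<open>
  Embed the urn in continuous time: each white unit dies at rate \<open>\<alpha>\<close>, and each black unit dies at
  rate \<open>\<delta>\<close>, leaving \<open>p\<close> white ones. Let \<open>A t = 1 + (v - 1) exp (- \<alpha> t)\<close> and let
  \<open>B\<close> be the inner integral. Then \<open>A' = \<alpha> (1 - A)\<close> and \<open>B' = \<delta> (A ^ p - B)\<close>, so
  integrating the derivative of \<open>A ^ n * B ^ (m - 1) * exp (- \<delta> t)\<close> over the half-line gives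
  exactly the one-step recurrence of the probability generating function. Hence the integral
  formula is a harmonic function of the urn chain. As \<open>n + (p + 1) m\<close> drops by one in every step
  until absorption, the chain is absorbed at a bounded time, and evaluating the harmonic function
  there gives the claim.
\<close>

section \<open>Calculus on the half-line\<close>

text \<open>The improper integral from 0 to \<infinity> ranges over the open half-line, which
  differs from \<open>{0..}\<close> by a null set. Continuity of \<open>F\<close> at 0 supplies the
  lower boundary value.\<close>

lemma set_integral_half_line_FTC:
  fixes F f :: "real \<Rightarrow> 'b::euclidean_space"
  assumes deriv: "\<And>t. (F has_vector_derivative f t) (at t)"
    and cont: "continuous_on UNIV f"
    and int: "set_integrable lborel {0..} f"
    and lim: "(F \<longlongrightarrow> 0) at_top"
  shows "(LBINT t:{0..}. f t) = - F 0"
proof -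
  have "set_integrable lborel (einterval 0 \<infinity>) f"
    by (rule set_integrable_subset[OF int]) (auto simp: einterval_iff)
  moreover have "isCont F 0"
    using deriv has_vector_derivative_continuous by blast
  then have "((F \<circ> real_of_ereal) \<longlongrightarrow> F 0) (at_right 0)"
    unfolding zero_ereal_def ereal_tendsto_simps
    by (simp add: filterlim_at_split isCont_def)
  ultimately have "(LBINT t=0..\<infinity>. f t) = 0 - F 0"
    using deriv cont lim
    by (intro interval_integral_FTC_integrable)
      (auto simp: continuous_on_eq_continuous_at ereal_tendsto_simps)
  moreover have "(LBINT t=0..\<infinity>. f t) = (LBINT t:{0..}. f t)"
    unfolding interval_lebesgue_integral_0_infty
    by (rule set_integral_discrete_difference[where X = "{0}"]) auto
  ultimately show ?thesis by simp
qed

lemma has_vector_derivative_of_real_exp: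
  "((\<lambda>x. of_real (exp (c * x)) :: complex) has_vector_derivative of_real (c * exp (c * t))) (at t)"
  by (rule has_vector_derivative_of_real) (auto intro!: derivative_eq_intros)

lemma has_vector_derivative_power_complex:
  fixes f :: "real \<Rightarrow> complex"
  assumes "(f has_vector_derivative f') (at t)"
  shows "((\<lambda>x. f x ^ n) has_vector_derivative of_nat n * f t ^ (n - 1) * f') (at t)"
proof -
  have "((\<lambda>z. z ^ n) has_field_derivative of_nat n * f t ^ (n - 1)) (at (f t))"
    by (auto intro!: derivative_eq_intros)
  from field_vector_diff_chain_at[OF assms this] show ?thesis
    by (simp add: o_def mult.commute)
qed

text \<open>Here \<open>t\<close> enters through both the limit and the integrand. Substituting
  \<open>s = t - u\<close> leaves \<open>exp (- \<delta> * t)\<close> times an integral of a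
  function free of \<open>t\<close>, which is easy to differentiate. For negative \<open>t\<close>
  the set integral is 0, so it need not be differentiable at 0; \<open>C\<close> extends it from the
  half-line to a solution on the whole line.\<close>

lemma exponential_convolution_ode:
  fixes a :: "real \<Rightarrow> complex" and \<delta> :: real
  assumes cont: "continuous_on UNIV a"
  obtains C where "C 0 = 0"
    and "\<And>t. (C has_vector_derivative of_real \<delta> * (a t - C t)) (at t)"
    and "\<And>t. t \<ge> 0 \<Longrightarrow>
      (LBINT u:{0..t}. of_real (\<delta> * exp (- \<delta> * u)) * a (t - u)) = C t"
proof -
  define g where "g s = of_real (\<delta> * exp (\<delta> * s)) * a s" for s
  have contg: "continuous_on UNIV g"
    unfolding g_def by (intro continuous_intros cont)
  have "\<exists>K. \<forall>x::real. - \<infinity> < ereal x \<longrightarrow> ereal x < \<infinity> \<longrightarrow> (K has_vector_derivative g x) (at x)"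
    by (rule einterval_antiderivative)
      (use contg in \<open>auto simp: continuous_on_eq_continuous_at\<close>)
  then obtain K where K: "\<And>x. (K has_vector_derivative g x) (at x)" by auto
  define C where "C t = of_real (exp (- \<delta> * t)) * (K t - K 0)" for t
  show thesis
  proof (rule that)
    show "C 0 = 0" by (simp add: C_def)
    show "(C has_vector_derivative of_real \<delta> * (a t - C t)) (at t)" for t
    proof -
      have "(C has_vector_derivative
          of_real (exp (- \<delta> * t)) * g t + of_real (- \<delta> * exp (- \<delta> * t)) * (K t - K 0)) (at t)"
        unfolding C_def[abs_def]
        by (rule has_vector_derivative_mult[OF has_vector_derivative_of_real_exp])
          (auto intro!: derivative_eq_intros K)
      moreover have "exp (- \<delta> * t) * (\<delta> * exp (\<delta> * t)) = \<delta>"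
        by (simp add: exp_minus)
      then have "of_real (exp (- \<delta> * t)) * g t = of_real \<delta> * a t"
        unfolding g_def by (metis mult.assoc of_real_mult)
      ultimately show ?thesis by (simp add: C_def algebra_simps)
    qed
    show "(LBINT u:{0..t}. of_real (\<delta> * exp (- \<delta> * u)) * a (t - u)) = C t" if "t \<ge> 0" for t
    proof -
      \<comment> \<open>For fixed \<open>t\<close> this is an antiderivative in \<open>u\<close>;
        its increment from 0 to \<open>t\<close> is exactly \<open>C t\<close>.\<close>
      define D where "D u = - of_real (exp (- \<delta> * t)) * K (t - u)" for u
      have D: "(D has_vector_derivative of_real (\<delta> * exp (- \<delta> * u)) * a (t - u)) (at u)" for u
      proof -
        have "((\<lambda>u. t - u) has_vector_derivative - 1) (at u)"
          by (auto intro!: derivative_eq_intros)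
        from vector_diff_chain_at[OF this K]
        have "((\<lambda>u. K (t - u)) has_vector_derivative - g (t - u)) (at u)"
          by (simp add: o_def)
        then have "(D has_vector_derivative - of_real (exp (- \<delta> * t)) * - g (t - u)) (at u)"
          unfolding D_def[abs_def] by (auto intro!: derivative_eq_intros)
        moreover have "exp (- \<delta> * t) * (\<delta> * exp (\<delta> * (t - u))) = \<delta> * exp (- \<delta> * u)"
          by (simp add: exp_add[symmetric] algebra_simps)
        then have "- of_real (exp (- \<delta> * t)) * - g (t - u) = of_real (\<delta> * exp (- \<delta> * u)) * a (t - u)"
          unfolding g_def by (metis minus_mult_minus mult.assoc of_real_mult)
        ultimately show ?thesis by metis
      qed
      have "(LBINT u:{0..t}. of_real (\<delta> * exp (- \<delta> * u)) * a (t - u)) = D t - D 0"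
        unfolding set_lebesgue_integral_def
        by (rule integral_FTC_atLeastAtMost[OF that])
          (intro D[THEN has_vector_derivative_at_within] continuous_intros
            continuous_on_compose2[OF cont] subset_UNIV)+
      then show ?thesis by (simp add: C_def D_def algebra_simps)
    qed
  qed
qed

section \<open>Integrals of the continuous-time embedding\<close>

text \<open>
  The generating functions of the number of white units that remain at time \<open>t\<close> from one
  white unit present at time \<open>0\<close>; and of the white units alive at time \<open>t\<close> that were left
  by one black unit, restricted to the event that the black unit has died by then.
\<close>

definition alive_pgf :: "real \<Rightarrow> complex \<Rightarrow> real \<Rightarrow> complex" where
  "alive_pgf \<alpha> v t = 1 + (v - 1) * of_real (exp (- \<alpha> * t))"

definition offspring_pgf :: "real \<Rightarrow> real \<Rightarrow> nat \<Rightarrow> complex \<Rightarrow> real \<Rightarrow> complex" where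
  "offspring_pgf \<alpha> \<delta> p v t =
     (LBINT u:{0..t}. of_real (\<delta> * exp (- \<delta> * u)) * alive_pgf \<alpha> v (t - u) ^ p)"

text \<open>Here \<open>k\<close> counts the black units other than the last one to die.\<close>

definition last_draw :: "real \<Rightarrow> real \<Rightarrow> nat \<Rightarrow> complex \<Rightarrow> nat \<Rightarrow> nat \<Rightarrow> real \<Rightarrow> complex" where
  "last_draw \<alpha> \<delta> p v n k t =
     alive_pgf \<alpha> v t ^ n * offspring_pgf \<alpha> \<delta> p v t ^ k * of_real (exp (- \<delta> * t))"

lemma continuous_on_alive_pgf: "continuous_on A (alive_pgf \<alpha> v)"
  unfolding alive_pgf_def by (intro continuous_intros)

lemma has_vector_derivative_alive_pgf:
  "(alive_pgf \<alpha> v has_vector_derivative of_real \<alpha> * (1 - alive_pgf \<alpha> v t)) (at t)"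
proof -
  have "(alive_pgf \<alpha> v has_vector_derivative 0 + (v - 1) * of_real (- \<alpha> * exp (- \<alpha> * t))) (at t)"
    unfolding alive_pgf_def[abs_def]
    by (intro has_vector_derivative_add has_vector_derivative_const
        has_vector_derivative_mult_right has_vector_derivative_of_real_exp)
  then show ?thesis by (simp add: alive_pgf_def algebra_simps)
qed

lemma norm_alive_pgf_le:
  assumes "\<alpha> \<ge> 0" "t \<ge> 0"
  shows "norm (alive_pgf \<alpha> v t) \<le> 1 + norm (v - 1)"
proof -
  have "norm (alive_pgf \<alpha> v t) \<le> norm (1::complex) + norm ((v - 1) * of_real (exp (- \<alpha> * t)))"
    unfolding alive_pgf_def by (rule norm_triangle_ineq)
  also have "\<dots> \<le> 1 + norm (v - 1) * 1"
    using assms by (auto simp: norm_mult intro!: mult_left_le)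
  finally show ?thesis by simp
qed

text \<open>The weight \<open>\<delta> * exp (- \<delta> * u)\<close> has mass
  \<open>1 - exp (- \<delta> * t)\<close>, at most 1, so the pointwise bound on
  \<open>alive_pgf\<close> survives the integration, uniformly in \<open>t\<close>.\<close>

lemma norm_offspring_pgf_le:
  assumes "\<alpha> \<ge> 0" "\<delta> \<ge> 0" "t \<ge> 0"
  shows "norm (offspring_pgf \<alpha> \<delta> p v t) \<le> (1 + norm (v - 1)) ^ p"
proof -
  let ?M = "(1 + norm (v - 1)) ^ p"
  let ?f = "\<lambda>u. of_real (\<delta> * exp (- \<delta> * u)) * alive_pgf \<alpha> v (t - u) ^ p"
  have "continuous_on {0..t} ?f"
    by (intro continuous_intros continuous_on_compose2[OF continuous_on_alive_pgf[of UNIV]]) auto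
  then have f: "set_integrable lborel {0..t} ?f"
    by (rule borel_integrable_atLeastAtMost')
  have g: "((\<lambda>u. \<delta> * exp (- \<delta> * u) * ?M) has_integral (- exp (- \<delta> * t) * ?M - - exp (- \<delta> * 0) * ?M)) {0..t}"
    using assms(3)
    by (intro fundamental_theorem_of_calculus)
      (auto intro!: derivative_eq_intros simp: has_real_derivative_iff_has_vector_derivative[symmetric])
  have "norm (integral {0..t} ?f) \<le> integral {0..t} (\<lambda>u. \<delta> * exp (- \<delta> * u) * ?M)"
  proof (rule integral_norm_bound_integral)
    show "?f integrable_on {0..t}" by (rule set_borel_integral_eq_integral[OF f])
    show "(\<lambda>u. \<delta> * exp (- \<delta> * u) * ?M) integrable_on {0..t}" using g by blast
    fix u assume "u \<in> {0..t}"
    then show "norm (?f u) \<le> \<delta> * exp (- \<delta> * u) * ?M"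
      using assms by (auto simp: norm_mult norm_power intro!: mult_left_mono power_mono norm_alive_pgf_le)
  qed
  also have "\<dots> = (1 - exp (- \<delta> * t)) * ?M"
    by (subst integral_unique[OF g]) (simp add: algebra_simps)
  also have "\<dots> \<le> ?M"
    using assms by (intro mult_left_le_one_le) auto
  finally show ?thesis
    unfolding offspring_pgf_def set_borel_integral_eq_integral(2)[OF f] .
qed

text \<open>This exponential majorant serves twice: it gives integrability and makes the boundary
  term at infinity vanish.\<close>

lemma last_draw_bound:
  assumes "\<alpha> \<ge> 0" "\<delta> \<ge> 0"
  obtains M where "\<And>t. t \<ge> 0 \<Longrightarrow> norm (last_draw \<alpha> \<delta> p v n k t) \<le> M * exp (- \<delta> * t)"
proof -
  let ?M = "1 + norm (v - 1)"
  show thesis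
    using assms
    by (intro that[of "?M ^ n * (?M ^ p) ^ k"])
      (auto simp: last_draw_def norm_mult norm_power
        intro!: mult_mono power_mono norm_alive_pgf_le norm_offspring_pgf_le)
qed

text \<open>Up to the factor \<open>\<delta>\<close> this is the exponential density, which is
  integrable because it defines a probability measure.\<close>

lemma set_integrable_exp_half_line:
  assumes "\<delta> > 0"
  shows "set_integrable lborel {0..} (\<lambda>t. exp (- \<delta> * t) :: real)"
proof -
  interpret prob_space "density lborel (exponential_density \<delta>)"
    using assms by (rule prob_space_exponential_density)
  have "integrable (density lborel (exponential_density \<delta>)) (\<lambda>x. 1::real)" by simp
  then have "integrable lborel (exponential_density \<delta>)"
    using assms by (subst (asm) integrable_density) (auto simp: exponential_density_nonneg)
  then have "integrable lborel (\<lambda>t. inverse \<delta> * exponential_density \<delta> t)" by simp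
  also have "(\<lambda>t. inverse \<delta> * exponential_density \<delta> t) = (\<lambda>t. indicator {0..} t *\<^sub>R exp (- \<delta> * t))"
    using assms by (auto simp: exponential_density_def fun_eq_iff indicator_def mult.commute)
  finally show ?thesis unfolding set_integrable_def .
qed

locale urn_embedding =
  fixes \<alpha> \<delta> :: real and p :: nat and v :: complex
  assumes \<alpha>_nonneg: "\<alpha> \<ge> 0" and \<delta>_pos: "\<delta> > 0"
begin

abbreviation "g \<equiv> last_draw \<alpha> \<delta> p v"

lemma offspring_ode:
  obtains C where "C 0 = 0"
    and "\<And>t. (C has_vector_derivative of_real \<delta> * (alive_pgf \<alpha> v t ^ p - C t)) (at t)"
    and "\<And>t. t \<ge> 0 \<Longrightarrow> offspring_pgf \<alpha> \<delta> p v t = C t"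
  by (rule exponential_convolution_ode[of "\<lambda>t. alive_pgf \<alpha> v t ^ p" \<delta>])
    (intro continuous_intros continuous_on_alive_pgf, rule that[unfolded offspring_pgf_def])

lemma last_draw_integrable: "set_integrable lborel {0..} (g n k)"
proof -
  obtain C where C: "C 0 = 0"
    "\<And>t. (C has_vector_derivative of_real \<delta> * (alive_pgf \<alpha> v t ^ p - C t)) (at t)"
    "\<And>t. t \<ge> 0 \<Longrightarrow> offspring_pgf \<alpha> \<delta> p v t = C t"
    by (rule offspring_ode) (rule that)
  have "continuous_on UNIV C"
    unfolding continuous_on_eq_continuous_at[OF open_UNIV]
    by (intro ballI has_vector_derivative_continuous[OF C(2)])
  then have "continuous_on UNIV (\<lambda>t. alive_pgf \<alpha> v t ^ n * C t ^ k * of_real (exp (- \<delta> * t)))"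
    by (intro continuous_intros continuous_on_alive_pgf)
  then have "set_borel_measurable lborel {0..} (\<lambda>t. alive_pgf \<alpha> v t ^ n * C t ^ k * of_real (exp (- \<delta> * t)))"
    unfolding set_borel_measurable_def
    by (intro borel_measurable_scaleR) (auto intro!: borel_measurable_continuous_onI)
  \<comment> \<open>Only \<open>t \<ge> 0\<close> matters here, and there the continuous function
    \<open>C\<close> agrees with \<open>offspring_pgf\<close>.\<close>
  also have "?this \<longleftrightarrow> set_borel_measurable lborel {0..} (g n k)"
    unfolding set_borel_measurable_def
    by (intro measurable_cong) (auto simp: last_draw_def C(3) indicator_def)
  finally have meas: "set_borel_measurable lborel {0..} (g n k)" .
  obtain M where M: "\<And>t. t \<ge> 0 \<Longrightarrow> norm (g n k t) \<le> M * exp (- \<delta> * t)"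
    by (rule last_draw_bound[OF \<alpha>_nonneg less_imp_le[OF \<delta>_pos]]) (rule that)
  have "set_integrable lborel {0..} (\<lambda>t. M * exp (- \<delta> * t))"
    by (intro set_integrable_mult_right set_integrable_exp_half_line \<delta>_pos)
  then show ?thesis
    by (rule set_integrable_bound[OF _ meas]) (use M in \<open>fastforce intro: AE_I2\<close>)
qed

text \<open>Integrate the derivative of \<open>g n k\<close>. With \<open>Suc k\<close> black units
  in the urn, the coefficient on the left is the total number of balls, and those on the right
  belong to the two colours. The term \<open>v ^ n\<close> is the boundary value at time 0.\<close>

lemma last_draw_recurrence:
  fixes n k :: nat
  shows "(of_real (\<alpha> * n + \<delta> * Suc k) :: complex) * (LBINT t:{0..}. g n k t) =
    of_real (\<alpha> * n) * (LBINT t:{0..}. g (n - 1) k t)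
    + (if k = 0 then v ^ n else of_real (\<delta> * k) * (LBINT t:{0..}. g (n + p) (k - 1) t))"
proof -
  obtain C where C: "C 0 = 0"
    "\<And>t. (C has_vector_derivative of_real \<delta> * (alive_pgf \<alpha> v t ^ p - C t)) (at t)"
    "\<And>t. t \<ge> 0 \<Longrightarrow> offspring_pgf \<alpha> \<delta> p v t = C t"
    by (rule offspring_ode) (rule that)
  let ?a = "alive_pgf \<alpha> v" and ?e = "\<lambda>t. of_real (exp (- \<delta> * t)) :: complex"
  define F where "F t = ?a t ^ n * C t ^ k * ?e t" for t
  \<comment> \<open>The negative coefficient collects \<open>\<alpha> * n\<close> from the powers of
    \<open>?a\<close>, \<open>\<delta> * k\<close> from those of \<open>C\<close>, and one more
    \<open>\<delta>\<close> from the exponential.\<close>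
  define f where "f t = of_real (\<alpha> * n) * (?a t ^ (n - 1) * C t ^ k * ?e t)
      + of_real (\<delta> * k) * (?a t ^ (n + p) * C t ^ (k - 1) * ?e t)
      - of_real (\<alpha> * n + \<delta> * Suc k) * (?a t ^ n * C t ^ k * ?e t)" for t
  have "continuous_on UNIV C"
    unfolding continuous_on_eq_continuous_at[OF open_UNIV]
    by (intro ballI has_vector_derivative_continuous[OF C(2)])
  then have contf: "continuous_on UNIV f"
    unfolding f_def by (intro continuous_intros continuous_on_alive_pgf)
  have deriv: "(F has_vector_derivative f t) (at t)" for t
  proof -
    have "(F has_vector_derivative
        ?a t ^ n * C t ^ k * of_real (- \<delta> * exp (- \<delta> * t)) +
        (?a t ^ n * (of_nat k * C t ^ (k - 1) * (of_real \<delta> * (?a t ^ p - C t))) +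
         of_nat n * ?a t ^ (n - 1) * (of_real \<alpha> * (1 - ?a t)) * C t ^ k) * ?e t) (at t)" (is "(_ has_vector_derivative ?D) _")
      unfolding F_def[abs_def]
      by (intro has_vector_derivative_mult has_vector_derivative_power_complex
          has_vector_derivative_alive_pgf has_vector_derivative_of_real_exp C(2))
    \<comment> \<open>The case split settles the truncated exponents \<open>n - 1\<close> and
      \<open>k - 1\<close>: at 0 their coefficients vanish.\<close>
    moreover have "?D = f t"
      unfolding f_def by (cases n; cases k) (simp_all add: algebra_simps power_add)
    ultimately show ?thesis by simp
  qed
  have fg: "f t = of_real (\<alpha> * n) * g (n - 1) k t + of_real (\<delta> * k) * g (n + p) (k - 1) t
      - of_real (\<alpha> * n + \<delta> * Suc k) * g n k t" if "t \<ge> 0" for t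
    using that by (simp add: f_def last_draw_def C(3))
  note I = last_draw_integrable
  have "set_integrable lborel {0..} (\<lambda>t. of_real (\<alpha> * n) * g (n - 1) k t
      + of_real (\<delta> * k) * g (n + p) (k - 1) t - of_real (\<alpha> * n + \<delta> * Suc k) * g n k t)"
    by (intro set_integral_diff set_integral_add set_integrable_mult_right I)
  also have "?this \<longleftrightarrow> set_integrable lborel {0..} f"
    by (rule set_integrable_cong) (simp_all add: fg)
  finally have int: "set_integrable lborel {0..} f" .
  obtain M where M: "\<And>t. t \<ge> 0 \<Longrightarrow> norm (g n k t) \<le> M * exp (- \<delta> * t)"
    by (rule last_draw_bound[OF \<alpha>_nonneg less_imp_le[OF \<delta>_pos]]) (rule that)
  have "(F \<longlongrightarrow> 0) at_top"
  proof (rule Lim_null_comparison)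
    show "\<forall>\<^sub>F t in at_top. norm (F t) \<le> M * exp (- \<delta> * t)"
      using eventually_ge_at_top[of 0]
      by eventually_elim (use M in \<open>simp add: F_def last_draw_def C(3)\<close>)
    have "((\<lambda>t. exp (- \<delta> * t)) \<longlongrightarrow> 0) at_top"
      by (rule filterlim_compose[OF exp_at_bot
            filterlim_tendsto_neg_mult_at_bot[OF tendsto_const _ filterlim_ident]])
        (use \<delta>_pos in simp)
    then show "((\<lambda>t. M * exp (- \<delta> * t)) \<longlongrightarrow> 0) at_top"
      by (rule tendsto_mult_right_zero)
  qed
  with deriv contf int have "(LBINT t:{0..}. f t) = - F 0"
    by (rule set_integral_half_line_FTC)
  \<comment> \<open>Since \<open>C 0 = 0\<close>, only the empty power \<open>k = 0\<close>
    survives; \<open>alive_pgf\<close> equals \<open>v\<close> at time 0.\<close>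
  also have "F 0 = (if k = 0 then v ^ n else 0)"
    by (simp add: F_def C(1) alive_pgf_def)
  also have "(LBINT t:{0..}. f t) = (LBINT t:{0..}. of_real (\<alpha> * n) * g (n - 1) k t
      + of_real (\<delta> * k) * g (n + p) (k - 1) t - of_real (\<alpha> * n + \<delta> * Suc k) * g n k t)"
    by (rule set_lebesgue_integral_cong) (auto simp: fg)
  also have "\<dots> = of_real (\<alpha> * n) * (LBINT t:{0..}. g (n - 1) k t)
      + of_real (\<delta> * k) * (LBINT t:{0..}. g (n + p) (k - 1) t)
      - of_real (\<alpha> * n + \<delta> * Suc k) * (LBINT t:{0..}. g n k t)"
    by (simp only: set_integral_diff(2) set_integral_add set_integrable_mult_right I
        set_integral_mult_right)
  finally show ?thesis by (auto simp: algebra_simps split: if_splits)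
qed

end

section \<open>Law of the finite histories of the chain\<close>

text \<open>The newest state comes first, so the head is the current state and one step of the chain
  is a \<open>Cons\<close>. The whole past is kept because \<open>transition\<close> speaks of whole
  paths.\<close>

fun history :: "(nat \<Rightarrow> 'a \<Rightarrow> 's) \<Rightarrow> nat \<Rightarrow> 'a \<Rightarrow> 's list" where
  "history S 0 \<omega> = [S 0 \<omega>]"
| "history S (Suc k) \<omega> = S (Suc k) \<omega> # history S k \<omega>"

fun history_pmf :: "('s \<Rightarrow> 's pmf) \<Rightarrow> 's \<Rightarrow> nat \<Rightarrow> 's list pmf" where
  "history_pmf K s 0 = return_pmf [s]"
| "history_pmf K s (Suc k) =
     bind_pmf (history_pmf K s k) (\<lambda>xs. map_pmf (\<lambda>x. x # xs) (K (hd xs)))"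

lemma hd_history [simp]: "hd (history S k \<omega>) = S k \<omega>"
  by (cases k) auto

lemma history_eq_iff:
  "history S k \<omega> = xs \<longleftrightarrow> length xs = Suc k \<and> (\<forall>i\<le>k. S i \<omega> = xs ! (k - i))"
proof (induction k arbitrary: xs)
  case 0
  show ?case by (cases xs) auto
next
  case (Suc k)
  show ?case
  proof (cases xs)
    case (Cons x ys)
    show ?thesis
      unfolding Cons by (auto simp: Suc.IH le_Suc_eq Suc_diff_le)
  qed simp
qed

text \<open>Only the past \<open>ys\<close> can be extended to \<open>y # ys\<close>, so the mixture
  collapses to one product, of the same shape as the one in \<open>transition\<close>.\<close>

lemma pmf_bind_map_Cons:
  "pmf (bind_pmf D (\<lambda>xs. map_pmf (\<lambda>x. x # xs) (K xs))) (y # ys) = pmf D ys * pmf (K ys) y"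
proof -
  have "pmf (map_pmf (\<lambda>x. x # xs) (K xs)) (y # ys) = indicator {ys} xs * pmf (K ys) y" for xs
  proof (cases "xs = ys")
    case True
    then show ?thesis using pmf_map_inj'[of "\<lambda>x. x # ys" "K ys" y] by (simp add: inj_def)
  next
    case False
    then show ?thesis by (auto simp: pmf_eq_0_set_pmf)
  qed
  then show ?thesis by (simp add: pmf_bind measure_pmf_single)
qed

context urn_process
begin

lemma measurable_history [measurable]: "history S k \<in> measurable P (count_space UNIV)"
proof (induction k)
  case 0
  show ?case using measurable_state[of 0] by simp
next
  case (Suc k)
  have "(\<lambda>\<omega>. (\<lambda>xs \<omega>. S (Suc k) \<omega> # xs) (history S k \<omega>) \<omega>) \<in> measurable P (count_space UNIV)"
    by (rule measurable_compose_countable[OF _ Suc])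
      (rule measurable_compose[OF measurable_state], simp)
  then show ?case by simp
qed

text \<open>Histories range over a countable type, so it suffices to compare point masses; both
  sides satisfy the same product recursion in \<open>k\<close>.\<close>

lemma distr_history: "distr P (count_space UNIV) (history S k) = measure_pmf (history_pmf (urn_step R) s\<^sub>0 k)"
proof (rule measure_eqI_countable[of _ UNIV])
  let ?D = "\<lambda>k. history_pmf (urn_step R) s\<^sub>0 k"
  have eq: "prob {\<omega> \<in> space P. history S k \<omega> = xs} = pmf (?D k) xs" for xs
  proof (induction k arbitrary: xs)
    case 0
    have "prob {\<omega> \<in> space P. history S 0 \<omega> = xs} = prob {\<omega> \<in> space P. [s\<^sub>0] = xs}"
    proof (rule measure_eq_AE)
      show "{\<omega> \<in> space P. history S 0 \<omega> = xs} \<in> events" by measurable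
    qed (use initial_state in auto)
    then show ?case by (auto simp: prob_space split: split_indicator)
  next
    case (Suc k)
    show ?case
    proof (cases xs)
      case Nil
      then show ?thesis by (auto simp: pmf_eq_0_set_pmf)
    next
      case (Cons y ys)
      show ?thesis
      proof (cases "length ys = Suc k")
        case True
        \<comment> \<open>This undoes the reversal: lists run backwards in time,
          \<open>transition\<close> forwards.\<close>
        define path where "path i = ys ! (k - i)" for i
        have hd: "hd ys = path k"
          using True by (simp add: path_def hd_conv_nth length_0_conv[symmetric] del: length_0_conv)
        have "{\<omega> \<in> space P. history S (Suc k) \<omega> = xs} =
            {\<omega> \<in> space P. (\<forall>i\<le>k. S i \<omega> = path i) \<and> S (Suc k) \<omega> = y}"
          using True by (auto simp: Cons history_eq_iff path_def)
        also have "prob \<dots> = prob {\<omega> \<in> space P. \<forall>i\<le>k. S i \<omega> = path i} * pmf (urn_step R (path k)) y"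
          by (rule transition)
        also have "{\<omega> \<in> space P. \<forall>i\<le>k. S i \<omega> = path i} = {\<omega> \<in> space P. history S k \<omega> = ys}"
          using True by (auto simp: history_eq_iff path_def)
        finally show ?thesis
          by (simp add: Suc.IH hd Cons pmf_bind_map_Cons)
      next
        case False
        \<comment> \<open>A list of the wrong length is never a history, and the induction
          hypothesis turns this into mass 0 on the other side.\<close>
        then have "history S k \<omega> \<noteq> ys" for \<omega>
          by (auto simp: history_eq_iff)
        then show ?thesis
          using Suc.IH[of ys] by (simp add: Cons pmf_bind_map_Cons)
      qed
    qed
  qed
  show "emeasure (distr P (count_space UNIV) (history S k)) {xs} = emeasure (?D k) {xs}" for xs
    by (simp add: emeasure_distr emeasure_pmf_single emeasure_eq_measure eq[symmetric]
        vimage_def Int_def conj_commute)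
qed auto

lemma AE_history: "AE \<omega> in P. history S k \<omega> \<in> set_pmf (history_pmf (urn_step R) s\<^sub>0 k)"
proof -
  have "AE xs in distr P (count_space UNIV) (history S k). xs \<in> set_pmf (history_pmf (urn_step R) s\<^sub>0 k)"
    unfolding distr_history by (rule AE_measure_pmf)
  then show ?thesis by (subst (asm) AE_distr_iff) auto
qed

text \<open>Outside countably many null sets each trajectory takes only possible steps, which allows
  pathwise arguments later.\<close>

lemma AE_admissible:
  "AE \<omega> in P. S 0 \<omega> = s\<^sub>0 \<and> (\<forall>k. S (Suc k) \<omega> \<in> set_pmf (urn_step R (S k \<omega>)))"
proof -
  have "AE \<omega> in P. S (Suc k) \<omega> \<in> set_pmf (urn_step R (S k \<omega>))" for k
    using AE_history[of "Suc k"] by eventually_elim auto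
  then show ?thesis
    using initial_state by (simp add: AE_all_countable)
qed

lemma expectation_state:
  fixes g :: "int \<times> int \<Rightarrow> 'b::{banach, second_countable_topology}"
  shows "expectation (\<lambda>\<omega>. g (S k \<omega>)) =
    measure_pmf.expectation (history_pmf (urn_step R) s\<^sub>0 k) (\<lambda>xs. g (hd xs))"
  unfolding distr_history[symmetric] by (subst integral_distr) auto

lemma measurable_remaining_white [measurable]:
  "remaining_white a S \<in> measurable P (count_space UNIV)"
proof -
  have "(\<lambda>\<omega>. LEAST k. snd (S k \<omega>) = 0) \<in> measurable P (count_space UNIV)"
    by (intro measurable_Least measurable_compose[OF measurable_state]) simp
  then have "(\<lambda>\<omega>. S (stopping_step S \<omega>) \<omega>) \<in> measurable P (count_space UNIV)"
    unfolding stopping_step_def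
    by (intro measurable_compose_countable[where f = S, OF measurable_state])
  then show ?thesis
    unfolding remaining_white_def[abs_def]
    by (rule measurable_compose[where g = "\<lambda>s. nat (fst s div int a)"]) simp
qed

end

section \<open>Harmonic functions of a chain\<close>

lemma hd_history_pmf_invariant:
  assumes "xs \<in> set_pmf (history_pmf K s k)" and "Q s"
    and "\<And>s s'. Q s \<Longrightarrow> s' \<in> set_pmf (K s) \<Longrightarrow> Q s'"
  shows "Q (hd xs)"
  using assms(1)
proof (induction k arbitrary: xs)
  case 0
  then show ?case using assms(2) by simp
next
  case (Suc k)
  then obtain x ys where "ys \<in> set_pmf (history_pmf K s k)" "x \<in> set_pmf (K (hd ys))" "xs = x # ys"
    by auto
  then show ?case using assms(3)[OF Suc.IH] by simp
qed

text \<open>Conditioning on the history up to time \<open>k\<close> shows that the expectation does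
  not change in one step. Finite supports turn all expectations into finite sums. The invariant
  \<open>Q\<close> confines the harmonicity condition to a closed set of states.\<close>

lemma expectation_history_pmf_harmonic:
  fixes \<phi> :: "'s \<Rightarrow> 'b::{banach, second_countable_topology}"
  assumes "Q s" and closed: "\<And>s s'. Q s \<Longrightarrow> s' \<in> set_pmf (K s) \<Longrightarrow> Q s'"
    and finite: "\<And>s. Q s \<Longrightarrow> finite (set_pmf (K s))"
    and harmonic: "\<And>s. Q s \<Longrightarrow> measure_pmf.expectation (K s) \<phi> = \<phi> s"
  shows "measure_pmf.expectation (history_pmf K s k) (\<lambda>xs. \<phi> (hd xs)) = \<phi> s"
proof -
  have inv: "Q (hd xs)" if "xs \<in> set_pmf (history_pmf K s k)" for xs k
    using that assms(1) closed by (rule hd_history_pmf_invariant)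
  have fin: "finite (set_pmf (history_pmf K s k))" for k
    by (induction k) (auto intro!: finite inv)
  show ?thesis
  proof (induction k)
    case 0
    show ?case by simp
  next
    case (Suc k)
    let ?D = "history_pmf K s k"
    have "measure_pmf.expectation (history_pmf K s (Suc k)) (\<lambda>xs. \<phi> (hd xs)) =
        (\<Sum>xs\<in>set_pmf ?D. pmf ?D xs *\<^sub>R measure_pmf.expectation (K (hd xs)) \<phi>)"
      using fin inv finite by (subst history_pmf.simps, subst pmf_expectation_bind) auto
    also have "\<dots> = (\<Sum>xs\<in>set_pmf ?D. pmf ?D xs *\<^sub>R \<phi> (hd xs))"
      by (intro sum.cong refl) (simp add: harmonic inv)
    also have "\<dots> = measure_pmf.expectation ?D (\<lambda>xs. \<phi> (hd xs))"
      by (rule integral_measure_pmf[symmetric]) (auto intro: fin)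
    finally show ?case using Suc by simp
  qed
qed

section \<open>Steps and trajectories of the urn\<close>

lemma urn_step_no_black [simp]: "urn_step R (w, 0) = return_pmf (w, 0)"
  by (simp add: urn_step_def)

lemma urn_step_black:
  assumes "b > 0"
  shows "urn_step R (w, b) = map_pmf
    (\<lambda>ball. if ball < w then (w + R$1$1, b + R$1$2) else (w + R$2$1, b + R$2$2)) (pmf_of_set {0..<w + b})"
  using assms by (simp add: urn_step_def)

text \<open>Without white balls the white row cannot be chosen; this is what keeps the white count
  from becoming negative.\<close>

lemma set_pmf_urn_step:
  assumes "w \<ge> 0" "b > 0"
  shows "set_pmf (urn_step R (w, b)) \<subseteq>
    (if w > 0 then {(w + R$1$1, b + R$1$2)} else {}) \<union> {(w + R$2$1, b + R$2$2)}"
  using assms by (auto simp: urn_step_black)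

text \<open>Of \<open>w + b\<close> equally likely balls, \<open>w\<close> are white. The equation
  is multiplied by the number of balls to match the form of
  \<open>last_draw_recurrence\<close>.\<close>

lemma expectation_urn_step:
  fixes g :: "int \<times> int \<Rightarrow> complex"
  assumes "w \<ge> 0" "b > 0"
  shows "of_int (w + b) * measure_pmf.expectation (urn_step R (w, b)) g =
    of_int w * g (w + R$1$1, b + R$1$2) + of_int b * g (w + R$2$1, b + R$2$2)"
proof -
  let ?A = "{0..<w + b}"
  let ?x = "(w + R$1$1, b + R$1$2)" and ?y = "(w + R$2$1, b + R$2$2)"
  have "measure_pmf.expectation (urn_step R (w, b)) g =
      (\<Sum>ball\<in>?A. pmf (pmf_of_set ?A) ball *\<^sub>R g (if ball < w then ?x else ?y))"
    using assms by (simp add: urn_step_black, subst integral_measure_pmf[of ?A]) auto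
  also have "\<dots> = (\<Sum>ball\<in>?A. (if ball < w then g ?x else g ?y) / of_int (w + b))"
    using assms by (intro sum.cong) (auto simp: scaleR_conv_of_real divide_simps)
  also have "\<dots> = (\<Sum>ball\<in>?A. if ball < w then g ?x else g ?y) / of_int (w + b)"
    by (simp add: sum_divide_distrib)
  also have "?A = {0..<w} \<union> {w..<w + b}"
    using assms by auto
  also have "(\<Sum>ball\<in>\<dots>. if ball < w then g ?x else g ?y) = of_int w * g ?x + of_int b * g ?y"
    using assms by (subst sum.union_disjoint) auto
  finally show ?thesis
    using assms by (simp add: field_simps flip: of_int_add)
qed

lemma triangular_urn_step_cases:
  fixes \<alpha> \<delta> p i j :: nat
  assumes "\<alpha> \<ge> 1" "\<delta> \<ge> 1"
    and R: "R = vector [vector [- int \<alpha>, 0], vector [int (\<alpha> * p), - int \<delta>]]"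
    and s: "s \<in> set_pmf (urn_step R (int (\<alpha> * i), int (\<delta> * Suc j)))"
  obtains i' where "i = Suc i'" "s = (int (\<alpha> * i'), int (\<delta> * Suc j))"
  | "s = (int (\<alpha> * (i + p)), int (\<delta> * j))"
proof -
  have "int (\<delta> * Suc j) > 0"
    unfolding of_nat_0_less_iff using assms(2) by simp
  then have "(i > 0 \<and> s = (int (\<alpha> * i) - int \<alpha>, int (\<delta> * Suc j))) \<or>
      s = (int (\<alpha> * i) + int (\<alpha> * p), int (\<delta> * Suc j) - int \<delta>)"
    using subsetD[OF set_pmf_urn_step s] assms(1)
    by (auto simp: R vector_2 zero_less_mult_iff split: if_splits)
  then show thesis
  proof
    assume *: "i > 0 \<and> s = (int (\<alpha> * i) - int \<alpha>, int (\<delta> * Suc j))"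
    then obtain i' where "i = Suc i'" by (cases i) auto
    with * show thesis by (intro that(1)[of i']) (auto simp: algebra_simps)
  next
    assume "s = (int (\<alpha> * i) + int (\<alpha> * p), int (\<delta> * Suc j) - int \<delta>)"
    then show thesis by (intro that(2)) (auto simp: algebra_simps)
  qed
qed

text \<open>A black unit weighs \<open>p + 1\<close> because it leaves \<open>p\<close> white ones:
  a black draw changes the potential by \<open>p - (p + 1)\<close>, a white draw by -1. Counts also
  remain nonnegative multiples of \<open>\<alpha>\<close> and \<open>\<delta>\<close>, so dividing
  by these is exact.\<close>

lemma triangular_urn_trajectory:
  fixes \<alpha> \<delta> p n m :: nat and X :: "nat \<Rightarrow> int \<times> int"
  assumes pos: "\<alpha> \<ge> 1" "\<delta> \<ge> 1"
    and R: "R = vector [vector [- int \<alpha>, 0], vector [int (\<alpha> * p), - int \<delta>]]"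
    and start: "X 0 = (int (\<alpha> * n), int (\<delta> * m))"
    and step: "\<And>k. X (Suc k) \<in> set_pmf (urn_step R (X k))"
  shows "\<exists>i j. X k = (int (\<alpha> * i), int (\<delta> * j)) \<and> (j = 0 \<or> i + (p + 1) * j + k = n + (p + 1) * m)"
proof (induction k)
  case 0
  show ?case using start by auto
next
  case (Suc k)
  then obtain i j where X: "X k = (int (\<alpha> * i), int (\<delta> * j))"
    and pot: "j = 0 \<or> i + (p + 1) * j + k = n + (p + 1) * m"
    by blast
  show ?case
  proof (cases j)
    case 0
    with X step[of k] show ?thesis by auto
  next
    case (Suc j')
    have "X (Suc k) \<in> set_pmf (urn_step R (int (\<alpha> * i), int (\<delta> * Suc j')))"
      using step[of k] by (simp only: X Suc)
    then show ?thesis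
    proof (rule triangular_urn_step_cases[OF pos R])
      fix i' assume "i = Suc i'" "X (Suc k) = (int (\<alpha> * i'), int (\<delta> * Suc j'))"
      with pot Suc show ?thesis by (intro exI[of _ i'] exI[of _ "Suc j'"]) auto
    next
      assume "X (Suc k) = (int (\<alpha> * (i + p)), int (\<delta> * j'))"
      with pot Suc show ?thesis by (intro exI[of _ "i + p"] exI[of _ j']) auto
    qed
  qed
qed

text \<open>The urn is frozen from the first time without black balls, so the random stopping step
  can be replaced by any fixed later time at which no black ball is left.\<close>

lemma state_at_stopping_step:
  assumes step: "\<And>k. S (Suc k) \<omega> \<in> set_pmf (urn_step R (S k \<omega>))"
    and absorbed: "snd (S N \<omega>) = 0"
  shows "S (stopping_step S \<omega>) \<omega> = S N \<omega>"
proof -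
  let ?T = "stopping_step S \<omega>"
  have zero: "snd (S ?T \<omega>) = 0"
    unfolding stopping_step_def using absorbed by (rule LeastI)
  have "?T \<le> N"
    unfolding stopping_step_def using absorbed by (rule Least_le)
  moreover have "S (?T + k) \<omega> = S ?T \<omega>" for k
  proof (induction k)
    case (Suc k)
    have "S ?T \<omega> = (fst (S ?T \<omega>), 0)"
      using zero by (simp add: prod_eq_iff)
    with step[of "?T + k"] Suc show ?case
      by (metis add_Suc_right set_return_pmf singletonD urn_step_no_black)
  qed simp
  ultimately show ?thesis by (metis le_Suc_ex)
qed

section \<open>The generating function and its integral formula\<close>

text \<open>The factor \<open>m\<close> chooses the black unit that dies last, \<open>v ^ p\<close>
  accounts for its offspring, and \<open>\<delta>\<close> completes the density of its death time.
  The case \<open>m = 0\<close> adds the absorbing boundary values.\<close>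

definition urn_pgf :: "nat \<Rightarrow> nat \<Rightarrow> nat \<Rightarrow> complex \<Rightarrow> nat \<Rightarrow> nat \<Rightarrow> complex" where
  "urn_pgf \<alpha> \<delta> p v n m =
     (if m = 0 then v ^ n
      else v ^ p * of_real (real m * real \<delta>) * (LBINT t:{0..}. last_draw \<alpha> \<delta> p v n (m - 1) t))"

text \<open>Multiply \<open>last_draw_recurrence\<close> by \<open>v ^ p\<close> and
  \<open>\<delta> * Suc k\<close>. For \<open>k = 0\<close> the boundary term becomes
  \<open>v ^ (n + p)\<close>; otherwise the coefficient \<open>\<delta> * k\<close> is the prefactor
  of the smaller urn.\<close>

lemma urn_pgf_recurrence:
  fixes \<alpha> \<delta> p n k :: nat
  assumes "\<delta> \<ge> 1"
  shows "of_nat (\<alpha> * n + \<delta> * Suc k) * urn_pgf \<alpha> \<delta> p v n (Suc k) =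
    of_nat (\<alpha> * n) * urn_pgf \<alpha> \<delta> p v (n - 1) (Suc k)
    + of_nat (\<delta> * Suc k) * urn_pgf \<alpha> \<delta> p v (n + p) k"
proof -
  interpret urn_embedding "real \<alpha>" "real \<delta>" p v
    by unfold_locales (use assms in auto)
  let ?I = "\<lambda>n k. LBINT t:{0..}. g n k t" and ?c = "v ^ p * of_real (real (Suc k) * real \<delta>)"
  have "of_nat (\<alpha> * n + \<delta> * Suc k) * urn_pgf \<alpha> \<delta> p v n (Suc k) =
      ?c * (of_real (real \<alpha> * n + real \<delta> * Suc k) * ?I n k)"
    by (simp add: urn_pgf_def algebra_simps)
  also have "\<dots> = ?c * (of_real (real \<alpha> * n) * ?I (n - 1) k
      + (if k = 0 then v ^ n else of_real (real \<delta> * k) * ?I (n + p) (k - 1)))"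
    by (simp only: last_draw_recurrence)
  also have "\<dots> = of_nat (\<alpha> * n) * urn_pgf \<alpha> \<delta> p v (n - 1) (Suc k)
      + of_nat (\<delta> * Suc k) * urn_pgf \<alpha> \<delta> p v (n + p) k"
    by (simp add: urn_pgf_def algebra_simps power_add)
  finally show ?thesis .
qed

lemma expectation_remaining_white:
  fixes \<alpha> \<delta> p n m :: nat
  assumes pos: "\<alpha> \<ge> 1" "\<delta> \<ge> 1"
    and R: "R = vector [vector [- int \<alpha>, 0], vector [int (\<alpha> * p), - int \<delta>]]"
    and "urn_process P R (int (\<alpha> * n), int (\<delta> * m)) S"
  shows "prob_space.expectation P (\<lambda>\<omega>. v ^ remaining_white \<alpha> S \<omega>) = urn_pgf \<alpha> \<delta> p v n m"
proof -
  interpret urn_process P R "(int (\<alpha> * n), int (\<delta> * m))" S by fact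
  define \<phi> where "\<phi> s = urn_pgf \<alpha> \<delta> p v (nat (fst s div int \<alpha>)) (nat (snd s div int \<delta>))"
    for s :: "int \<times> int"
  define Q where "Q s \<longleftrightarrow> (\<exists>i j. s = (int (\<alpha> * i), int (\<delta> * j)))" for s
  \<comment> \<open>The initial potential bounds the absorption time.\<close>
  define N where "N = n + (p + 1) * m"
  have \<phi>: "\<phi> (int (\<alpha> * i), int (\<delta> * j)) = urn_pgf \<alpha> \<delta> p v i j" for i j
    using pos by (simp add: \<phi>_def)
  have closed: "Q s'" if "Q s" "s' \<in> set_pmf (urn_step R s)" for s s'
  proof -
    obtain i j where s: "s = (int (\<alpha> * i), int (\<delta> * j))" using \<open>Q s\<close> unfolding Q_def by blast
    show ?thesis
    proof (cases j)
      case 0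
      with that s show ?thesis by simp
    next
      case (Suc j')
      show ?thesis
        unfolding Q_def by (rule triangular_urn_step_cases[OF pos R that(2)[unfolded s Suc]]) blast+
    qed
  qed
  have finite_step: "finite (set_pmf (urn_step R s))" if "Q s" for s
  proof -
    obtain i j where s: "s = (int (\<alpha> * i), int (\<delta> * j))" using \<open>Q s\<close> unfolding Q_def by blast
    show ?thesis
    proof (cases j)
      case (Suc j')
      then have "int (\<delta> * j) > 0"
        unfolding of_nat_0_less_iff using pos by simp
      then show ?thesis
        unfolding s by (intro finite_subset[OF set_pmf_urn_step]) auto
    qed (simp add: s)
  qed
  have harmonic: "measure_pmf.expectation (urn_step R s) \<phi> = \<phi> s" if "Q s" for s
  proof -
    obtain i j where s: "s = (int (\<alpha> * i), int (\<delta> * j))" using \<open>Q s\<close> unfolding Q_def by blast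
    show ?thesis
    proof (cases j)
      case (Suc k)
      let ?E = "measure_pmf.expectation (urn_step R s) \<phi>"
      have b_pos: "int (\<delta> * Suc k) > 0"
        unfolding of_nat_0_less_iff using pos by simp
      \<comment> \<open>For \<open>i = 0\<close> the state on the left has a negative white count,
        but its weight is 0.\<close>
      have white: "of_nat (\<alpha> * i) * \<phi> (int (\<alpha> * i) + R$1$1, int (\<delta> * Suc k) + R$1$2) =
          of_nat (\<alpha> * i) * urn_pgf \<alpha> \<delta> p v (i - 1) (Suc k)"
      proof (cases i)
        case (Suc i')
        have "(int (\<alpha> * i) + R$1$1, int (\<delta> * Suc k) + R$1$2) = (int (\<alpha> * i'), int (\<delta> * Suc k))"
          by (simp add: R vector_2 Suc algebra_simps)
        then show ?thesis by (simp only: \<phi> Suc diff_Suc_1)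
      qed simp
      have black: "(int (\<alpha> * i) + R$2$1, int (\<delta> * Suc k) + R$2$2) = (int (\<alpha> * (i + p)), int (\<delta> * k))"
        by (simp add: R vector_2 algebra_simps)
      have "of_nat (\<alpha> * i + \<delta> * Suc k) * ?E =
          of_nat (\<alpha> * i) * \<phi> (int (\<alpha> * i) + R$1$1, int (\<delta> * Suc k) + R$1$2)
          + of_nat (\<delta> * Suc k) * \<phi> (int (\<alpha> * i) + R$2$1, int (\<delta> * Suc k) + R$2$2)"
        using expectation_urn_step[OF of_nat_0_le_iff b_pos, of "\<alpha> * i" R \<phi>]
        by (simp add: s Suc)
      also have "\<dots> = of_nat (\<alpha> * i + \<delta> * Suc k) * urn_pgf \<alpha> \<delta> p v i (Suc k)"
        by (simp only: white black \<phi> urn_pgf_recurrence[OF pos(2)])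
      finally have "of_nat (\<alpha> * i + \<delta> * Suc k) * ?E = of_nat (\<alpha> * i + \<delta> * Suc k) * \<phi> s"
        by (simp only: s Suc \<phi>)
      moreover have "(of_nat (\<alpha> * i + \<delta> * Suc k) :: complex) \<noteq> 0"
        unfolding of_nat_eq_0_iff using pos by simp
      ultimately show ?thesis by (simp only: mult_cancel_left) simp
    qed (simp add: s)
  qed
  have "AE \<omega> in P. v ^ remaining_white \<alpha> S \<omega> = \<phi> (S N \<omega>)"
    using AE_admissible
  proof eventually_elim
    case (elim \<omega>)
    then obtain i j where SN: "S N \<omega> = (int (\<alpha> * i), int (\<delta> * j))"
      and "j = 0 \<or> i + (p + 1) * j + N = n + (p + 1) * m"
      using triangular_urn_trajectory[OF pos R, of "\<lambda>k. S k \<omega>" n m N] by auto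
    \<comment> \<open>If the potential identity holds at time \<open>N\<close>, it leaves
      \<open>i + (p + 1) * j = 0\<close>.\<close>
    then have "j = 0" by (auto simp: N_def)
    moreover from this have "S (stopping_step S \<omega>) \<omega> = S N \<omega>"
      using elim SN by (intro state_at_stopping_step) auto
    ultimately show ?case
      using pos by (simp add: remaining_white_def SN \<phi>_def urn_pgf_def)
  qed
  then have "expectation (\<lambda>\<omega>. v ^ remaining_white \<alpha> S \<omega>) = expectation (\<lambda>\<omega>. \<phi> (S N \<omega>))"
    by (intro integral_cong_AE measurable_compose[OF measurable_remaining_white]
        measurable_compose[OF measurable_state]) auto
  also have "\<dots> = measure_pmf.expectation
      (history_pmf (urn_step R) (int (\<alpha> * n), int (\<delta> * m)) N) (\<lambda>xs. \<phi> (hd xs))"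
    by (rule expectation_state)
  also have "\<dots> = \<phi> (int (\<alpha> * n), int (\<delta> * m))"
    by (rule expectation_history_pmf_harmonic[where Q = Q])
      (use closed finite_step harmonic in \<open>auto simp: Q_def simp del: of_nat_mult\<close>)
  finally show ?thesis by (simp only: \<phi>)
qed

theorem theorem1:
  fixes \<alpha> \<delta> p \<gamma> n m :: nat and R :: "int^2^2"
    and P :: "'a measure" and S :: "nat \<Rightarrow> 'a \<Rightarrow> int \<times> int"
    and v :: complex
  assumes "\<alpha> \<ge> 1" and "\<delta> \<ge> 1" and "m \<ge> 1"
    and "\<gamma> = \<alpha> * p"
    and "R = vector [vector [- int \<alpha>, 0], vector [int \<gamma>, - int \<delta>]]"
    and "urn_process P R (int (\<alpha> * n), int (\<delta> * m)) S"
  shows "let f = (\<lambda>t::real.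
      (1 + (v - 1) * of_real (exp (- real \<alpha> * t))) ^ n
      * (LBINT u:{0..t}. of_real (real \<delta> * exp (- real \<delta> * u))
                          * (1 + (v - 1) * of_real (exp (- real \<alpha> * (t - u)))) ^ p) ^ (m - 1)
      * v ^ p * of_real (real m * real \<delta> * exp (- real \<delta> * t)))
    in set_integrable lborel {0..} f
      \<and> prob_space.expectation P (\<lambda>\<omega>. v ^ remaining_white \<alpha> S \<omega>) = (LBINT t:{0..}. f t)"
proof -
  interpret urn_embedding "real \<alpha>" "real \<delta>" p v
    by unfold_locales (use assms in auto)
  define f where "f t =
      (1 + (v - 1) * of_real (exp (- real \<alpha> * t))) ^ n
      * (LBINT u:{0..t}. of_real (real \<delta> * exp (- real \<delta> * u))
                          * (1 + (v - 1) * of_real (exp (- real \<alpha> * (t - u)))) ^ p) ^ (m - 1)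
      * v ^ p * of_real (real m * real \<delta> * exp (- real \<delta> * t))" for t
  have f: "f t = v ^ p * of_real (real m * real \<delta>) * g n (m - 1) t" for t
    unfolding f_def last_draw_def offspring_pgf_def alive_pgf_def by (simp only: of_real_mult ac_simps)
  \<comment> \<open>A non-integrable function has integral 0 by convention, so this conjunct ensures
    that the formula states a genuine integral.\<close>
  have "set_integrable lborel {0..} f"
    unfolding f by (intro set_integrable_mult_right last_draw_integrable)
  moreover have "(LBINT t:{0..}. f t) = urn_pgf \<alpha> \<delta> p v n m"
    unfolding f urn_pgf_def using assms(3) by (simp del: of_real_mult)
  moreover have "prob_space.expectation P (\<lambda>\<omega>. v ^ remaining_white \<alpha> S \<omega>) = urn_pgf \<alpha> \<delta> p v n m"
    using assms by (intro expectation_remaining_white) auto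
  ultimately show ?thesis
    unfolding Let_def f_def[symmetric] by simp
qed

end
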